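(* Let $G=(I,(S_i)_{i\in I},(g_i)_{i\in I})$ be a pure strategy game with $|I|<\infty$, and let $P$ be a group set of $G$. Suppose that each $S_i$ is a convex compact set in a topological vector space, and each $g_i$ is continuous and partially analytic. Then for a joint strategy $s\in\prod_{i\in I}S_i$, the best response group count $N(s)$ is a local minimum if and only if, for every joint strategy $t\in T(s)$, every group in $P$ that achieves best response in $s$ also achieves best response in $t$.
   Context: A pure strategy game is a tuple $G=(I,(S_i)_{i\in I},(g_i)_{i\in I})$ with $I$ a finite set of players, $S_i$ the strategy set of player $i$, and $g_i:\prod_{j\in I}S_j\to\mathbb{R}$ the payoff function of player $i$. Products carry the product topology. A joint strategy is an element $s=(s_i)_{i\in I}$ of $\prod_{i\in I}S_i$; $s_{-i}$ denotes $(s_j)_{j\ne i}$. Best response: $BR(s_{-i})=\{r\in S_i: g_i(r,s_{-i})\ge \sup_{t\in S_i}g_i(t,s_{-i})\}$. Player $i$ achieves best response in $s$ if $s_i\in BR(s_{-i})$. Group set: a set $P$ of pairwise disjoint subsets of $I$ with $\bigcup_{p\in P}p=I$; its elements are called groups. A group $p$ achieves best response in $s$ if every $i\in p$ does. Best response group count: $N(s)=|\{p\in P: \forall i\in p,\ s_i\in BR(s_{-i})\}|$. Admissible subsequent joint strategy set: $T(s)$ is the set of all $s'\in\prod_{i\in I}S_i$ such that for every $p\in P$: if $s_i\in BR(s_{-i})$ for all $i\in p$, then $s'_i=s_i$ for all $i\in p$. $N(s)$ is called a local minimum if $N(s)\le\inf_{t\in T(s)}N(t)$. Partially analytic: if each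 $X_i$ $(i\in I)$ is a convex set in a topological vector space, $f:\prod_{i\in I}X_i\to\mathbb{R}$ is partially analytic if for every $i\in I$, $p_i,q_i\in X_i$ and $x_{-i}\in\prod_{j\ne i}X_j$, the function $[0,1]\to\mathbb{R}$, $a\mapsto f(ap_i+(1-a)q_i,x_{-i})$ is real analytic in $a$. *)

theory Defs
  imports "HOL-Analysis.Analysis"
begin

text \<open>
  A real topological vector space is given by a topology whose underlying set is a linear subspace
  of an ambient type \<open>'v\<close>; \<open>'v\<close> itself carries no topology. So each player can have a different
  topological vector space: any family of real vector spaces embeds linearly into a common one
  (their direct sum), and the topologies on the individual subspaces are unrelated to each other.
  The Hausdorff property is not required.
\<close>

definition topological_vector_space :: "'v::real_vector topology \<Rightarrow> bool" where
  "topological_vector_space X \<longleftrightarrow>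
     subspace (topspace X) \<and>
     continuous_map (prod_topology X X) X (\<lambda>(x, y). x + y) \<and>
     continuous_map (prod_topology euclideanreal X) X (\<lambda>(c, x). c *\<^sub>R x)"

text \<open>
  At points of \<open>A\<close> that are not interior (such as the endpoints of an interval) the power series
  has to represent \<open>f\<close> on the part of a neighbourhood that lies in \<open>A\<close>.
\<close>

definition real_analytic_on :: "(real \<Rightarrow> real) \<Rightarrow> real set \<Rightarrow> bool"
    (infix "real'_analytic'_on" 50) where
  "f real_analytic_on A \<longleftrightarrow>
     (\<forall>a\<in>A. \<exists>\<epsilon>>0. \<exists>c :: nat \<Rightarrow> real. \<forall>x\<in>A. \<bar>x - a\<bar> < \<epsilon> \<longrightarrow> (\<lambda>n. c n * (x - a) ^ n) sums f x)"

definition partially_analytic ::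
    "'i set \<Rightarrow> ('i \<Rightarrow> 'v::real_vector set) \<Rightarrow> (('i \<Rightarrow> 'v) \<Rightarrow> real) \<Rightarrow> bool" where
  "partially_analytic I X f \<longleftrightarrow>
     (\<forall>i\<in>I. \<forall>p\<in>X i. \<forall>q\<in>X i. \<forall>x\<in>PiE (I - {i}) X.
        (\<lambda>a. f (x(i := a *\<^sub>R p + (1 - a) *\<^sub>R q))) real_analytic_on {0..1})"

text \<open>
  A pure strategy game consists of the finite set \<open>I\<close> of players, the strategy sets \<open>S i\<close> and the
  payoff functions \<open>g i\<close>; joint strategies are the elements of \<open>PiE I S\<close>.

  In \<open>best_response S g i s\<close> the value \<open>s i\<close> is always overwritten, so only
  \<open>s\<^sub>-\<^sub>i\<close> matters. The supremum is taken in the extended reals, where it exists even if the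
  payoff is unbounded.
\<close>

definition best_response ::
    "('i \<Rightarrow> 'v set) \<Rightarrow> ('i \<Rightarrow> ('i \<Rightarrow> 'v) \<Rightarrow> real) \<Rightarrow> 'i \<Rightarrow> ('i \<Rightarrow> 'v) \<Rightarrow> 'v set" where
  "best_response S g i s =
     {r \<in> S i. ereal (g i (s(i := r))) \<ge> (SUP t\<in>S i. ereal (g i (s(i := t))))}"

text \<open>Unlike \<^const>\<open>partition_on\<close>, a group set may contain the empty group.\<close>

definition group_set :: "'i set \<Rightarrow> 'i set set \<Rightarrow> bool" where
  "group_set I P \<longleftrightarrow> disjoint P \<and> \<Union>P = I"

definition achieves_best_response ::
    "('i \<Rightarrow> 'v set) \<Rightarrow> ('i \<Rightarrow> ('i \<Rightarrow> 'v) \<Rightarrow> real) \<Rightarrow> 'i set \<Rightarrow> ('i \<Rightarrow> 'v) \<Rightarrow> bool" where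
  "achieves_best_response S g p s \<longleftrightarrow> (\<forall>i\<in>p. s i \<in> best_response S g i s)"

definition group_count ::
    "('i \<Rightarrow> 'v set) \<Rightarrow> ('i \<Rightarrow> ('i \<Rightarrow> 'v) \<Rightarrow> real) \<Rightarrow> 'i set set \<Rightarrow> ('i \<Rightarrow> 'v) \<Rightarrow> nat" where
  "group_count S g P s = card {p \<in> P. achieves_best_response S g p s}"

definition admissible ::
    "'i set \<Rightarrow> ('i \<Rightarrow> 'v set) \<Rightarrow> ('i \<Rightarrow> ('i \<Rightarrow> 'v) \<Rightarrow> real) \<Rightarrow> 'i set set \<Rightarrow> ('i \<Rightarrow> 'v) \<Rightarrow>
      ('i \<Rightarrow> 'v) set" where
  "admissible I S g P s =
     {s' \<in> PiE I S. \<forall>p\<in>P. achieves_best_response S g p s \<longrightarrow> (\<forall>i\<in>p. s' i = s i)}"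

text \<open>
  The infimum is that of \<^typ>\<open>nat\<close>; its index set is never empty for a joint strategy \<open>s\<close>, since
  \<open>s\<close> itself is admissible.
\<close>

definition local_minimum ::
    "'i set \<Rightarrow> ('i \<Rightarrow> 'v set) \<Rightarrow> ('i \<Rightarrow> ('i \<Rightarrow> 'v) \<Rightarrow> real) \<Rightarrow> 'i set set \<Rightarrow> ('i \<Rightarrow> 'v) \<Rightarrow> bool" where
  "local_minimum I S g P s \<longleftrightarrow>
     group_count S g P s \<le> (INF t\<in>admissible I S g P s. group_count S g P t)"

end

theory Submission
  imports Defs "HOL-Complex_Analysis.Cauchy_Integral_Formula"
begin

text \<open>
  If player \<open>j\<close> does not achieve best response in \<open>s\<close>, then \<open>g j\<close> is not constant in its own
  coordinate at \<open>s\<^sub>-\<^sub>j\<close>. By the identity theorem along segments, applied one coordinate at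
  a time, this persists for joint strategies arbitrarily close to any given \<open>t\<close>, and a further small
  move of player \<open>j\<close> then leaves the maximum. So missing best response is an open and dense
  condition on the strategies that differ from \<open>s\<close> only in players free to move. If a group achieves
  best response in \<open>s\<close> but not in some \<open>t\<close> in \<open>T(s)\<close>, one can therefore perturb \<open>t\<close> within \<open>T(s)\<close> to
  make all groups that miss best response in \<open>s\<close> miss it again, which contradicts the minimality.
\<close>

section \<open>Real analytic functions on the unit interval\<close>

lemma real_analytic_on_const: "(\<lambda>x. k) real_analytic_on A"
proof -
  have "(\<lambda>n. (if n = 0 then k else 0) * y ^ n) sums k" for y :: real
    using sums_single[of 0 "\<lambda>n. k * y ^ n"] by (simp add: if_distrib if_distribR cong: if_cong)
  then show ?thesis
    unfolding real_analytic_on_def by (metis zero_less_one)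
qed

lemma real_analytic_on_diff:
  assumes "f real_analytic_on A" "h real_analytic_on A"
  shows "(\<lambda>x. f x - h x) real_analytic_on A"
  unfolding real_analytic_on_def
proof
  fix a assume a: "a \<in> A"
  obtain e c where e: "e > 0" "\<forall>x\<in>A. \<bar>x - a\<bar> < e \<longrightarrow> (\<lambda>n. c n * (x - a) ^ n) sums f x"
    using assms(1) a unfolding real_analytic_on_def by blast
  obtain e' c' where e': "e' > 0" "\<forall>x\<in>A. \<bar>x - a\<bar> < e' \<longrightarrow> (\<lambda>n. c' n * (x - a) ^ n) sums h x"
    using assms(2) a unfolding real_analytic_on_def by blast
  have "\<forall>x\<in>A. \<bar>x - a\<bar> < min e e' \<longrightarrow> (\<lambda>n. (c n - c' n) * (x - a) ^ n) sums (f x - h x)"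
    using e(2) e'(2) by (auto simp: left_diff_distrib intro!: sums_diff)
  then show "\<exists>\<epsilon>>0. \<exists>c. \<forall>x\<in>A. \<bar>x - a\<bar> < \<epsilon> \<longrightarrow> (\<lambda>n. c n * (x - a) ^ n) sums (f x - h x)"
    using e(1) e'(1) by (metis min_less_iff_conj)
qed

text \<open>The two cases are whether or not all coefficients of the local expansion vanish: zeros
  of a nonzero power series cannot accumulate at its centre.\<close>

lemma real_analytic_zero_or_isolated_zeros:
  assumes f: "f real_analytic_on {0..1}" and a: "a \<in> {0..1}"
  obtains e where "e > 0"
    "(\<forall>x\<in>{0..1}. \<bar>x - a\<bar> < e \<longrightarrow> f x = 0) \<or> (\<forall>x\<in>{0..1}. 0 < \<bar>x - a\<bar> \<and> \<bar>x - a\<bar> < e \<longrightarrow> f x \<noteq> 0)"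
proof -
  obtain e c where e: "e > 0"
    and c: "\<And>x. x \<in> {0..1} \<Longrightarrow> \<bar>x - a\<bar> < e \<Longrightarrow> (\<lambda>n. c n * (x - a) ^ n) sums f x"
    using f a unfolding real_analytic_on_def by blast
  \<comment> \<open>A radius below 1/2 guarantees that \<open>a + d\<close> or \<open>a - d\<close>
    lies in the unit interval.\<close>
  define d where "d = min e (1/2) / 2"
  have d: "d > 0" "d < e" "d < 1/2" using e by (auto simp: d_def)
  have "\<exists>x\<in>{0..1}. \<bar>x - a\<bar> = d"
  proof (cases "a \<le> 1/2")
    case True
    then show ?thesis using d a by (intro bexI[of _ "a + d"]) auto
  next
    case False
    then show ?thesis using d a by (intro bexI[of _ "a - d"]) auto
  qed
  then obtain x0 where x0: "x0 \<in> {0..1}" "\<bar>x0 - a\<bar> = d" by blast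
  \<comment> \<open>At an endpoint the expansion is given on one side only. Convergence at the
    single point \<open>x0\<close> still yields convergence for both signs of \<open>y\<close>,
    hence on the full disc that \<open>powser_0_nonzero\<close> asks for.\<close>
  have sm: "summable (\<lambda>n. c n * y ^ n)" if "\<bar>y\<bar> < d" for y
    using powser_inside[OF sums_summable[OF c[OF x0(1)]], of y] x0(2) d that by simp
  define F where "F y = (\<Sum>n. c n * y ^ n)" for y
  have F: "(\<lambda>n. c n * y ^ n) sums F y" if "\<bar>y\<bar> < d" for y
    using sm[OF that] by (simp add: F_def summable_sums)
  have fF: "f x = F (x - a)" if "x \<in> {0..1}" "\<bar>x - a\<bar> < d" for x
    using c[of x] F[of "x - a"] that d by (auto intro: sums_unique2)
  show thesis
  proof (cases "\<forall>n. c n = 0")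
    case True
    then have "F y = 0" for y by (simp add: F_def)
    then show thesis using fF d(1) by (intro that[of d]) auto
  next
    case False
    then obtain m where m: "c m \<noteq> 0" by blast
    \<comment> \<open>The factor \<open>y\<close> makes the function vanish at 0, as \<open>powser_0_nonzero\<close> requires.\<close>
    have G: "(\<lambda>n. (case n of 0 \<Rightarrow> 0 | Suc k \<Rightarrow> c k) * (y - 0) ^ n) sums (y * F y)"
      if "norm (y - 0) < d" for y
    proof -
      have "(\<lambda>n. y * (c n * y ^ n)) sums (y * F y)"
        using F that by (intro sums_mult) auto
      then show ?thesis
        using sums_Suc_iff[of "\<lambda>n. (case n of 0 \<Rightarrow> 0 | Suc k \<Rightarrow> c k) * y ^ n" "y * F y"]
        by (simp add: mult_ac)
    qed
    \<comment> \<open>The factor \<open>y\<close> shifts the coefficients, so \<open>c m\<close>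
      sits at index \<open>Suc m\<close>.\<close>
    obtain r where r: "0 < r" "\<And>z. z \<in> cball 0 r - {0} \<Longrightarrow> z * F z \<noteq> 0"
      using powser_0_nonzero[OF d(1) G, of "Suc m"] m by auto
    have "f x \<noteq> 0" if "x \<in> {0..1}" "0 < \<bar>x - a\<bar>" "\<bar>x - a\<bar> < min d r" for x
      using r(2)[of "x - a"] fF[of x] that by (auto simp: dist_norm abs_minus_commute)
    then show thesis using d(1) r(1) by (intro that[of "min d r"]) auto
  qed
qed

text \<open>Identity theorem by connectedness: \<open>A\<close> and \<open>B\<close> are disjoint
  relatively open sets covering the interval, so one is empty. Since \<open>b\<close> is not in
  \<open>A\<close>, that one is \<open>A\<close>, and 0 lies in \<open>B\<close>.\<close>

lemma real_analytic_nonzero_near_0: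
  assumes f: "f real_analytic_on {0..1}" and b: "b \<in> {0..1}" "f b \<noteq> 0" and "e > 0"
  obtains x where "0 < x" "x < e" "x \<le> 1" "f x \<noteq> 0"
proof -
  define A where "A = {a \<in> {0..1}. \<exists>e>0. \<forall>x\<in>{0..1}. \<bar>x - a\<bar> < e \<longrightarrow> f x = 0}"
  define B where "B = {a \<in> {0..1}. \<exists>e>0. \<forall>x\<in>{0..1}. 0 < \<bar>x - a\<bar> \<and> \<bar>x - a\<bar> < e \<longrightarrow> f x \<noteq> 0}"
  have cover: "{0..1} \<subseteq> A \<union> B"
  proof
    fix a :: real assume "a \<in> {0..1}"
    with real_analytic_zero_or_isolated_zeros[OF f this] show "a \<in> A \<union> B"
      by (auto simp: A_def B_def) metis+
  qed
  have disj: "A \<inter> B = {}"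
  proof -
    have False if a: "a \<in> A" "a \<in> B" for a
    proof -
      obtain e1 where e1: "e1 > 0" "\<forall>x\<in>{0..1}. \<bar>x - a\<bar> < e1 \<longrightarrow> f x = 0"
        using a(1) by (auto simp: A_def)
      obtain e2 where e2: "e2 > 0" "\<forall>x\<in>{0..1}. 0 < \<bar>x - a\<bar> \<and> \<bar>x - a\<bar> < e2 \<longrightarrow> f x \<noteq> 0"
        using a(2) by (auto simp: B_def)
      \<comment> \<open>A point of the interval at distance \<open>d\<close> from \<open>a\<close>
        would be both a zero and a nonzero of \<open>f\<close>.\<close>
      define d where "d = min (min e1 e2) (1/2) / 2"
      have d: "0 < d" "d < e1" "d < e2" "d < 1/2" using e1(1) e2(1) by (auto simp: d_def)
      have "a \<in> {0..1}" using a(1) by (simp add: A_def)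
      then have "a + d \<in> {0..1} \<or> a - d \<in> {0..1}" using d by auto
      then show False using e1(2) e2(2) d by fastforce
    qed
    then show ?thesis by blast
  qed
  have "openin (top_of_set {0..1}) A"
    unfolding openin_euclidean_subtopology_iff
  proof (intro conjI ballI)
    fix a assume a: "a \<in> A"
    then obtain d where d: "d > 0" "\<forall>x\<in>{0..1}. \<bar>x - a\<bar> < d \<longrightarrow> f x = 0" by (auto simp: A_def)
    have "y \<in> A" if "y \<in> {0..1}" "dist y a < d" for y
      unfolding A_def using that d
      by (auto simp: dist_real_def intro!: exI[of _ "d - \<bar>y - a\<bar>"])
    then show "\<exists>e>0. \<forall>x'\<in>{0..1}. dist x' a < e \<longrightarrow> x' \<in> A" using d(1) by blast
  qed (auto simp: A_def)
  moreover have "openin (top_of_set {0..1}) B"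
    unfolding openin_euclidean_subtopology_iff
  proof (intro conjI ballI)
    fix a assume a: "a \<in> B"
    then obtain d where d: "d > 0" "\<forall>x\<in>{0..1}. 0 < \<bar>x - a\<bar> \<and> \<bar>x - a\<bar> < d \<longrightarrow> f x \<noteq> 0"
      by (auto simp: B_def)
    have "y \<in> B" if "y \<in> {0..1}" "dist y a < d" for y
    proof (cases "y = a")
      case False
      \<comment> \<open>This ball around \<open>y\<close> avoids \<open>a\<close> and stays within
        distance \<open>d\<close> of it, so \<open>f\<close> has no zero in it, not even at
        \<open>y\<close>.\<close>
      have "f x \<noteq> 0" if "x \<in> {0..1}" "\<bar>x - y\<bar> < min \<bar>y - a\<bar> (d - \<bar>y - a\<bar>)" for x
        using that by (intro d(2)[rule_format]) auto
      moreover have "min \<bar>y - a\<bar> (d - \<bar>y - a\<bar>) > 0"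
        using False that(2) by (auto simp: dist_real_def)
      ultimately show ?thesis unfolding B_def using that(1) by blast
    qed (use a in simp)
    then show "\<exists>e>0. \<forall>x'\<in>{0..1}. dist x' a < e \<longrightarrow> x' \<in> B" using d(1) by blast
  qed (auto simp: B_def)
  ultimately have "A = {} \<or> B = {}"
    using connected_Icc[of "0::real" 1] cover disj unfolding connected_openin by blast
  moreover have "b \<notin> A" using b by (auto simp: A_def intro!: bexI[of _ b])
  ultimately have "0 \<in> B"
    using cover b(1) by fastforce
  then obtain d where d: "d > 0" "\<forall>x\<in>{0..1}. 0 < \<bar>x\<bar> \<and> \<bar>x\<bar> < d \<longrightarrow> f x \<noteq> 0"
    by (auto simp: B_def)
  show thesis
    by (rule that[of "min (min d e) 1 / 2"]) (use d \<open>e > 0\<close> in auto)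
qed

section \<open>Payoff differences and improving deviations\<close>

text \<open>Along coordinate \<open>j\<close> both terms are overwritten and the difference is
  constant; along any other coordinate the updates commute. A nonzero difference shows that a payoff
  depends on its player's own strategy.\<close>

lemma partially_analytic_own_coordinate_diff:
  assumes f: "partially_analytic I X f" and j: "j \<in> I" and p: "p \<in> X j" and q: "q \<in> X j"
  shows "partially_analytic I X (\<lambda>x. f (x(j := p)) - f (x(j := q)))"
  unfolding partially_analytic_def
proof (intro ballI)
  fix i u v x
  assume i: "i \<in> I" and uv: "u \<in> X i" "v \<in> X i" and x: "x \<in> PiE (I - {i}) X"
  show "(\<lambda>a. f ((x(i := a *\<^sub>R u + (1 - a) *\<^sub>R v))(j := p)) -
             f ((x(i := a *\<^sub>R u + (1 - a) *\<^sub>R v))(j := q))) real_analytic_on {0..1}"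
  proof (cases "i = j")
    case True
    then show ?thesis by (simp add: real_analytic_on_const)
  next
    case False
    have "x(j := r) \<in> PiE (I - {i}) X" if "r \<in> X j" for r
      using x that False j by (auto simp: PiE_iff extensional_def)
    then show ?thesis
      using False f i uv p q
      by (auto simp: fun_upd_twist partially_analytic_def intro!: real_analytic_on_diff)
  qed
qed

lemma not_best_response_iff:
  assumes "s j \<in> S j"
  shows "s j \<notin> best_response S g j s \<longleftrightarrow> (\<exists>r\<in>S j. g j s < g j (s(j := r)))"
  using assms by (auto simp: best_response_def SUP_le_iff not_le)

section \<open>Product topology, segments and coordinate updates\<close>

locale convex_strategies =
  fixes I :: "'i set" and V :: "'i \<Rightarrow> 'v::real_vector topology" and S :: "'i \<Rightarrow> 'v set"
  assumes tvs: "i \<in> I \<Longrightarrow> topological_vector_space (V i)"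
    and convex_S: "i \<in> I \<Longrightarrow> convex (S i)"
    and S_subset: "i \<in> I \<Longrightarrow> S i \<subseteq> topspace (V i)"
begin

definition X :: "('i \<Rightarrow> 'v) topology" where
  "X = product_topology (\<lambda>j. subtopology (V j) (S j)) I"

lemma topspace_X: "topspace X = PiE I S"
  unfolding X_def topspace_product_topology using S_subset by (auto intro!: PiE_cong)

lemma segment_in: "i \<in> I \<Longrightarrow> p \<in> S i \<Longrightarrow> q \<in> S i \<Longrightarrow> 0 \<le> a \<Longrightarrow> a \<le> 1 \<Longrightarrow> a *\<^sub>R p + (1 - a) *\<^sub>R q \<in> S i"
  using convexD[OF convex_S, of i p q a "1 - a"] by auto

lemma upd_in: "x \<in> PiE I S \<Longrightarrow> i \<in> I \<Longrightarrow> p \<in> S i \<Longrightarrow> x(i := p) \<in> PiE I S"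
  by (auto simp: PiE_iff extensional_def)

lemma continuous_map_segment:
  assumes i: "i \<in> I" and p: "p \<in> S i" and q: "q \<in> S i"
  shows "continuous_map (top_of_set {0..1}) (subtopology (V i) (S i)) (\<lambda>a. a *\<^sub>R p + (1 - a) *\<^sub>R q)"
proof -
  let ?T = "top_of_set {0..1::real}"
  have add: "continuous_map (prod_topology (V i) (V i)) (V i) (\<lambda>(x, y). x + y)"
    and scale: "continuous_map (prod_topology euclideanreal (V i)) (V i) (\<lambda>(c, x). c *\<^sub>R x)"
    using tvs[OF i] by (auto simp: topological_vector_space_def)
  have sc: "continuous_map ?T (V i) (\<lambda>a. h a *\<^sub>R r)"
    if "continuous_on {0..1} h" "r \<in> S i" for h r
  proof -
    have "continuous_map ?T (prod_topology euclideanreal (V i)) (\<lambda>a. (h a, r))"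
      using that S_subset[OF i] by (intro continuous_map_pairedI) auto
    from continuous_map_compose[OF this scale] show ?thesis by (simp add: o_def)
  qed
  have "continuous_map ?T (prod_topology (V i) (V i)) (\<lambda>a. (a *\<^sub>R p, (1 - a) *\<^sub>R q))"
    using p q by (intro continuous_map_pairedI sc continuous_intros)
  from continuous_map_compose[OF this add]
  have "continuous_map ?T (V i) (\<lambda>a. a *\<^sub>R p + (1 - a) *\<^sub>R q)" by (simp add: o_def)
  then show ?thesis
    using segment_in[OF i p q] by (auto simp: continuous_map_in_subtopology)
qed

lemma continuous_map_upd_segment:
  assumes x: "x \<in> PiE I S" and i: "i \<in> I" and p: "p \<in> S i" and q: "q \<in> S i"
  shows "continuous_map (top_of_set {0..1}) X (\<lambda>a. x(i := a *\<^sub>R p + (1 - a) *\<^sub>R q))"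
  unfolding X_def continuous_map_componentwise
proof (intro conjI ballI)
  show "(\<lambda>a. x(i := a *\<^sub>R p + (1 - a) *\<^sub>R q)) ` topspace (top_of_set {0..1}) \<subseteq> extensional I"
    using x i by (auto simp: PiE_iff extensional_def)
  fix k assume k: "k \<in> I"
  show "continuous_map (top_of_set {0..1}) (subtopology (V k) (S k))
          (\<lambda>a. (x(i := a *\<^sub>R p + (1 - a) *\<^sub>R q)) k)"
    using continuous_map_segment[OF i p q] x k S_subset[OF k] by (cases "k = i") auto
qed

lemma continuous_map_upd:
  assumes i: "i \<in> I" and p: "p \<in> S i"
  shows "continuous_map X X (\<lambda>x. x(i := p))"
  unfolding X_def continuous_map_componentwise
proof (intro conjI ballI)
  show "(\<lambda>x. x(i := p)) ` topspace (product_topology (\<lambda>j. subtopology (V j) (S j)) I) \<subseteq> extensional I"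
    using i by (auto simp: PiE_iff extensional_def)
  fix k assume k: "k \<in> I"
  show "continuous_map (product_topology (\<lambda>j. subtopology (V j) (S j)) I) (subtopology (V k) (S k))
          (\<lambda>x. (x(i := p)) k)"
    using p S_subset[OF k] continuous_map_product_projection[OF k, of "\<lambda>j. subtopology (V j) (S j)"]
    by (cases "k = i") auto
qed

section \<open>Nonvanishing of partially analytic functions near every point\<close>

text \<open>On the segment from \<open>x i\<close> at \<open>a = 0\<close> to \<open>p\<close> at
  \<open>a = 1\<close>, \<open>f\<close> is nonzero at 1, hence at arbitrarily small
  \<open>a > 0\<close>; continuity keeps such points in \<open>U\<close>.\<close>

lemma segment_nonzero_in_open:
  assumes f: "partially_analytic I S f" and x: "x \<in> PiE I S" and i: "i \<in> I" and p: "p \<in> S i"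
    and nz: "f (x(i := p)) \<noteq> 0" and U: "openin X U" "x \<in> U"
  obtains y where "y \<in> S i" "x(i := y) \<in> U" "f (x(i := y)) \<noteq> 0"
proof -
  let ?h = "\<lambda>a. x(i := a *\<^sub>R p + (1 - a) *\<^sub>R x i)"
  have xi: "x i \<in> S i" using x i by auto
  \<comment> \<open>\<open>partially_analytic\<close> quantifies over points without coordinate
    \<open>i\<close>; the update at \<open>i\<close> hides the restriction.\<close>
  have r: "restrict x (I - {i}) \<in> PiE (I - {i}) S" using x by auto
  have req: "(restrict x (I - {i}))(i := u) = x(i := u)" for u
    using x by (auto simp: fun_eq_iff PiE_iff extensional_def)
  have an: "(\<lambda>a. f (?h a)) real_analytic_on {0..1}"
    using f[unfolded partially_analytic_def, rule_format, OF i p xi r] by (simp only: req)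
  define W where "W = {a \<in> {0..1}. ?h a \<in> U}"
  have "openin (top_of_set {0..1}) W"
    using openin_continuous_map_preimage[OF continuous_map_upd_segment[OF x i p xi] U(1)]
    by (simp add: W_def)
  moreover have "0 \<in> W" using U(2) by (simp add: W_def)
  ultimately obtain e where "e > 0" "\<forall>a\<in>{0..1}. dist a 0 < e \<longrightarrow> a \<in> W"
    unfolding openin_euclidean_subtopology_iff by blast
  then have e: "e > 0" "\<And>a. a \<in> {0..1} \<Longrightarrow> dist a 0 < e \<Longrightarrow> ?h a \<in> U"
    by (auto simp: W_def)
  obtain a where a: "0 < a" "a < e" "a \<le> 1" "f (?h a) \<noteq> 0"
    using real_analytic_nonzero_near_0[OF an, of 1 e] nz e(1) by auto
  show thesis
    by (rule that[of "a *\<^sub>R p + (1 - a) *\<^sub>R x i"]) (use a e(2)[of a] segment_in[OF i p xi] in auto)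
qed

text \<open>Nonvanishing is carried from \<open>s\<close> to a neighbourhood of \<open>t\<close> by
  changing one differing coordinate at a time. The last conclusion is what later keeps perturbations
  admissible.\<close>

lemma nonzero_in_open:
  assumes I: "finite I" and f: "partially_analytic I S f" and s: "s \<in> PiE I S" and nz: "f s \<noteq> 0"
    and U: "openin X U" "t \<in> U"
  obtains y where "y \<in> U" "f y \<noteq> 0" "\<And>i. t i = s i \<Longrightarrow> y i = s i"
proof -
  \<comment> \<open>\<open>D\<close> bounds the coordinates where \<open>t\<close> and
    \<open>s\<close> differ. Both \<open>t\<close> and \<open>U\<close> vary, because the step
    applies the hypothesis to \<open>t(i := s i)\<close> and to another open set.\<close>
  have "\<exists>y\<in>U. f y \<noteq> 0 \<and> (\<forall>i. t i = s i \<longrightarrow> y i = s i)"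
    if D: "finite D" "{i\<in>I. t i \<noteq> s i} \<subseteq> D" and U: "openin X U" "t \<in> U" for t U D
    using D U
  proof (induction D arbitrary: t U rule: finite_induct)
    case empty
    have "t \<in> PiE I S" using openin_subset[OF empty(2)] empty(3) topspace_X by auto
    then have "t = s" using empty(1) s by (intro PiE_ext[of _ I S]) auto
    then show ?case using empty(3) nz by auto
  next
    case (insert i D)
    have t: "t \<in> PiE I S" using openin_subset[OF insert(5)] insert(6) topspace_X by auto
    show ?case
    proof (cases "i \<in> I \<and> t i \<noteq> s i")
      case False
      then show ?thesis using insert by (intro insert.IH) auto
    next
      case True
      have ti: "t i \<in> S i" and si: "s i \<in> S i" using t s True by auto
      \<comment> \<open>Writing \<open>t i\<close> back into coordinate \<open>i\<close> sends
        \<open>t(i := s i)\<close> to \<open>t\<close>, so this preimage of \<open>U\<close> is a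
        neighbourhood of \<open>t(i := s i)\<close>.\<close>
      let ?W = "{x \<in> topspace X. x(i := t i) \<in> U}"
      have "t(i := s i) \<in> ?W"
        using insert(6) upd_in[OF t _ si] True by (simp add: topspace_X)
      moreover have "openin X ?W"
        using openin_continuous_map_preimage[OF continuous_map_upd[OF _ ti] insert(5)] True by simp
      moreover have "{k \<in> I. (t(i := s i)) k \<noteq> s k} \<subseteq> D" using insert(4) by auto
      ultimately obtain y where y: "y \<in> ?W" "f y \<noteq> 0" "\<And>k. (t(i := s i)) k = s k \<Longrightarrow> y k = s k"
        using insert.IH by blast
      have yi: "y i = s i" using y(3)[of i] by simp
      have yS: "y \<in> PiE I S" using y(1) by (simp add: topspace_X)
      \<comment> \<open>The segment starts at \<open>y(i := t i)\<close>, which lies in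
        \<open>U\<close>, and ends at \<open>y\<close>, where \<open>f\<close> is nonzero.\<close>
      have "f ((y(i := t i))(i := s i)) \<noteq> 0" using y(2) yi by (simp flip: yi)
      then obtain z where z: "z \<in> S i" "(y(i := t i))(i := z) \<in> U" "f ((y(i := t i))(i := z)) \<noteq> 0"
        using segment_nonzero_in_open[OF f upd_in[OF yS _ ti] _ si _ insert(5)] True y(1) by auto
      have "\<forall>k. t k = s k \<longrightarrow> (y(i := z)) k = s k"
        using y(3) True by auto
      moreover have "y(i := z) \<in> U" "f (y(i := z)) \<noteq> 0" using z by simp_all
      ultimately show ?thesis by blast
    qed
  qed
  from this[of "I" t U] I U show thesis using that by auto
qed

section \<open>Openness and density of missing best response\<close>

text \<open>For each fixed deviation \<open>r\<close>, strict improvement is an open condition, and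
  the set is the union of these over \<open>r\<close>.\<close>

lemma openin_not_best_response:
  assumes j: "j \<in> I" and g: "continuous_map X euclideanreal (g j)"
  shows "openin X {x \<in> topspace X. x j \<notin> best_response S g j x}"
proof -
  have "{x \<in> topspace X. x j \<notin> best_response S g j x} =
      (\<Union>r\<in>S j. {x \<in> topspace X. g j (x(j := r)) - g j x \<in> {0<..}})"
    using j not_best_response_iff[of _ j S g] by (auto simp: topspace_X PiE_iff)
  moreover have "openin X {x \<in> topspace X. g j (x(j := r)) - g j x \<in> {0<..}}" if "r \<in> S j" for r
    using continuous_map_compose[OF continuous_map_upd[OF j that] g] g
    by (intro openin_continuous_map_preimage[where Y = euclideanreal] continuous_map_diff)
       (auto simp: o_def)
  ultimately show ?thesis by auto
qed

text \<open>First \<open>x\<close> is found where \<open>g j\<close> depends on coordinate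
  \<open>j\<close>. If \<open>x j\<close> is a best response there, a small move of \<open>j\<close>
  to a different payoff must lower it. This move is why the last conclusion excludes
  \<open>j\<close>.\<close>

lemma not_best_response_dense:
  assumes I: "finite I" and j: "j \<in> I" and g: "partially_analytic I S (g j)"
    and s: "s \<in> PiE I S" "s j \<notin> best_response S g j s"
    and U: "openin X U" "t \<in> U"
  obtains y where "y \<in> U" "y j \<notin> best_response S g j y" "\<And>i. i \<noteq> j \<Longrightarrow> t i = s i \<Longrightarrow> y i = s i"
proof -
  have sj: "s j \<in> S j" using s j by auto
  obtain r where r: "r \<in> S j" "g j s < g j (s(j := r))"
    using s(2) not_best_response_iff[of s j S g] sj by auto
  let ?f = "\<lambda>x. g j (x(j := r)) - g j (x(j := s j))"
  obtain x where x: "x \<in> U" "?f x \<noteq> 0" "\<And>i. t i = s i \<Longrightarrow> x i = s i"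
    using nonzero_in_open[OF I partially_analytic_own_coordinate_diff[OF g j r(1) sj] s(1) _ U] r(2)
    by auto
  have xS: "x \<in> PiE I S" using openin_subset[OF U(1)] x(1) topspace_X by auto
  then have xj: "x j \<in> S j" using j by auto
  show thesis
  proof (cases "x j \<in> best_response S g j x")
    case False
    then show thesis using x by (intro that[of x]) auto
  next
    case True
    \<comment> \<open>The payoffs at \<open>r\<close> and at \<open>s j\<close> differ, so at least
      one of them differs from \<open>g j x\<close>.\<close>
    obtain b where b: "b \<in> S j" "g j (x(j := b)) \<noteq> g j x"
      using x(2) r(1) sj by (cases "g j (x(j := r)) = g j x") auto
    have "partially_analytic I S (\<lambda>y. g j y - g j x)"
      using g by (auto simp: partially_analytic_def intro: real_analytic_on_diff real_analytic_on_const)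
    then obtain z where z: "z \<in> S j" "x(j := z) \<in> U" "g j (x(j := z)) - g j x \<noteq> 0"
      using segment_nonzero_in_open[of "\<lambda>y. g j y - g j x", OF _ xS j b(1) _ U(1) x(1)] b(2) by auto
    have "g j (x(j := z)) \<le> g j x"
      using True not_best_response_iff[of x j S g] xj z(1) by force
    \<comment> \<open>Returning to \<open>x j\<close> is now a strict improvement.\<close>
    then have "(x(j := z)) j \<notin> best_response S g j (x(j := z))"
      using z xj by (subst not_best_response_iff) (auto intro!: bexI[of _ "x j"])
    then show thesis using z x(3) by (intro that[of "x(j := z)"]) auto
  qed
qed

lemma openin_not_achieves:
  assumes p: "p \<subseteq> I" and g: "\<And>i. i \<in> I \<Longrightarrow> continuous_map X euclideanreal (g i)"
  shows "openin X {x \<in> topspace X. \<not> achieves_best_response S g p x}"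
proof -
  have "{x \<in> topspace X. \<not> achieves_best_response S g p x} =
      (\<Union>j\<in>p. {x \<in> topspace X. x j \<notin> best_response S g j x})"
    by (auto simp: achieves_best_response_def)
  then show ?thesis
    using p openin_not_best_response[of _ g] g by (auto intro!: openin_Union)
qed

lemma not_achieves_dense:
  assumes I: "finite I" and cont: "\<And>i. i \<in> I \<Longrightarrow> continuous_map X euclideanreal (g i)"
    and an: "\<And>i. i \<in> I \<Longrightarrow> partially_analytic I S (g i)"
    and s: "s \<in> PiE I S" and Q: "finite Q"
    and Q_miss: "\<And>q. q \<in> Q \<Longrightarrow> q \<subseteq> I \<and> q \<inter> C = {} \<and> \<not> achieves_best_response S g q s"
    and U: "openin X U" "t \<in> U" and t: "\<And>i. i \<in> C \<Longrightarrow> t i = s i"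
  obtains y where "y \<in> U" "\<And>i. i \<in> C \<Longrightarrow> y i = s i"
    "\<And>q. q \<in> Q \<Longrightarrow> \<not> achieves_best_response S g q y"
proof -
  have "\<exists>y\<in>U. (\<forall>i\<in>C. y i = s i) \<and> (\<forall>q\<in>Q. \<not> achieves_best_response S g q y)"
    using Q Q_miss U t
  proof (induction Q arbitrary: t U rule: finite_induct)
    case empty
    then show ?case by auto
  next
    case (insert q Q)
    have q: "q \<subseteq> I" "q \<inter> C = {}" "\<not> achieves_best_response S g q s" using insert.prems(1) by auto
    then obtain j where j: "j \<in> q" "s j \<notin> best_response S g j s"
      by (auto simp: achieves_best_response_def)
    then have jI: "j \<in> I" and jC: "j \<notin> C" using q by auto
    obtain x where x: "x \<in> U" "x j \<notin> best_response S g j x" "\<And>i. i \<noteq> j \<Longrightarrow> t i = s i \<Longrightarrow> x i = s i"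
      using not_best_response_dense[OF I jI an[OF jI] s j(2) insert.prems(2,3)] by blast
    let ?W = "U \<inter> {x \<in> topspace X. \<not> achieves_best_response S g q x}"
    have "openin X ?W" using insert.prems(2) openin_not_achieves[OF q(1), of g] cont by (intro openin_Int) auto
    moreover have "x \<in> ?W"
      using x j(1) openin_subset[OF insert.prems(2)] by (auto simp: achieves_best_response_def)
    moreover have "x i = s i" if "i \<in> C" for i
      using that jC x(3) insert.prems(4) by metis
    ultimately have "\<exists>y\<in>?W. (\<forall>i\<in>C. y i = s i) \<and> (\<forall>q\<in>Q. \<not> achieves_best_response S g q y)"
      using insert.prems(1) by (intro insert.IH[of ?W x]) auto
    then show ?case by auto
  qed
  then show thesis using that by blast
qed

end

section \<open>Comparison of group counts\<close>

theorem theorem1: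
  fixes I :: "'i set"
    and V :: "'i \<Rightarrow> 'v::real_vector topology"
    and S :: "'i \<Rightarrow> 'v set"
    and g :: "'i \<Rightarrow> ('i \<Rightarrow> 'v) \<Rightarrow> real"
    and P :: "'i set set"
    and s :: "'i \<Rightarrow> 'v"
  assumes "finite I"
    and "group_set I P"
    and "\<And>i. i \<in> I \<Longrightarrow> topological_vector_space (V i)"
    and "\<And>i. i \<in> I \<Longrightarrow> convex (S i)"
    and "\<And>i. i \<in> I \<Longrightarrow> compactin (V i) (S i)"
    and "\<And>i. i \<in> I \<Longrightarrow>
           continuous_map (product_topology (\<lambda>j. subtopology (V j) (S j)) I) euclideanreal (g i)"
    and "\<And>i. i \<in> I \<Longrightarrow> partially_analytic I S (g i)"
    and "s \<in> PiE I S"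
  shows "local_minimum I S g P s \<longleftrightarrow>
    (\<forall>t\<in>admissible I S g P s. \<forall>p\<in>P.
       achieves_best_response S g p s \<longrightarrow> achieves_best_response S g p t)"
proof -
  interpret convex_strategies I V S
    using assms(3,4,5) by unfold_locales (auto dest: subsetD[OF compactin_subset_topspace])
  have disj: "disjoint P" and UP: "\<Union>P = I" using assms(2) by (auto simp: group_set_def)
  have finP: "finite P" using assms(1) UP finite_UnionD by blast
  have cont: "\<And>i. i \<in> I \<Longrightarrow> continuous_map X euclideanreal (g i)"
    using assms(6) by (simp add: X_def)
  have "s \<in> admissible I S g P s" using assms(8) by (simp add: admissible_def)
  then have lm: "local_minimum I S g P s \<longleftrightarrow>
      (\<forall>t\<in>admissible I S g P s. group_count S g P s \<le> group_count S g P t)"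
    unfolding local_minimum_def by (subst le_cINF_iff) auto
  show ?thesis
    unfolding lm
  proof (intro iffI ballI impI)
    fix t p
    assume min: "\<forall>t\<in>admissible I S g P s. group_count S g P s \<le> group_count S g P t"
      and t: "t \<in> admissible I S g P s" and p: "p \<in> P" "achieves_best_response S g p s"
    show "achieves_best_response S g p t"
    proof (rule ccontr)
      assume not: "\<not> achieves_best_response S g p t"
      \<comment> \<open>For joint strategies, agreeing with \<open>s\<close> on \<open>C\<close> is
        exactly admissibility.\<close>
      define C where "C = \<Union>{q \<in> P. achieves_best_response S g q s}"
      define Q where "Q = {q \<in> P. \<not> achieves_best_response S g q s}"
      let ?U = "{x \<in> topspace X. \<not> achieves_best_response S g p x}"
      have tS: "t \<in> PiE I S" and tC: "\<And>i. i \<in> C \<Longrightarrow> t i = s i"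
        using t by (auto simp: admissible_def C_def)
      have U: "openin X ?U" "t \<in> ?U"
        using openin_not_achieves[of p g] cont p(1) UP not tS by (auto simp: topspace_X)
      \<comment> \<open>A group in \<open>Q\<close> differs from every group making up
        \<open>C\<close>, so disjointness of \<open>P\<close> applies.\<close>
      have "q \<inter> C = {}" if "q \<in> Q" for q
      proof -
        have "q \<inter> q' = {}" if "q' \<in> P" "achieves_best_response S g q' s" for q'
          using disjointD[OF disj, of q q'] that \<open>q \<in> Q\<close> by (auto simp: Q_def)
        then show ?thesis by (auto simp: C_def)
      qed
      then have Q: "q \<subseteq> I \<and> q \<inter> C = {} \<and> \<not> achieves_best_response S g q s" if "q \<in> Q" for q
        using that UP by (auto simp: Q_def)
      have "finite Q" using finP by (simp add: Q_def)
      then obtain y where y: "y \<in> ?U" "\<And>i. i \<in> C \<Longrightarrow> y i = s i"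
        "\<And>q. q \<in> Q \<Longrightarrow> \<not> achieves_best_response S g q y"
        using not_achieves_dense[where g = g and s = s and C = C and Q = Q, OF assms(1) cont assms(7,8) _ Q U tC]
        by blast
      have "y \<in> admissible I S g P s"
        using y(1,2) by (auto simp: admissible_def topspace_X C_def)
      \<comment> \<open>Groups in \<open>Q\<close> still miss at \<open>y\<close>, so none is
        gained; \<open>p\<close> is lost, so the inclusion is strict.\<close>
      moreover have "{q \<in> P. achieves_best_response S g q y} \<subset> {q \<in> P. achieves_best_response S g q s}"
        using y(1,3) p by (auto simp: Q_def)
      then have "group_count S g P y < group_count S g P s"
        unfolding group_count_def using finP by (intro psubset_card_mono) auto
      ultimately show False using min by fastforce
    qed
  next
    fix t
    assume "\<forall>t\<in>admissible I S g P s. \<forall>p\<in>P.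
        achieves_best_response S g p s \<longrightarrow> achieves_best_response S g p t"
      and "t \<in> admissible I S g P s"
    then show "group_count S g P s \<le> group_count S g P t"
      unfolding group_count_def using finP by (intro card_mono) auto
  qed
qed

end
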